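(* If $\mathrel{\perp\!\!\!\perp}$ is federated and admits an algebraic point, then $\mathrm{AIRAIndL}(\mathrel{\perp\!\!\!\perp})$ is complete: for every set $\Sigma$ of independence atoms, if $\Sigma \models \vec{x} \perp \vec{y}$ then $\Sigma \vdash \vec{x} \perp \vec{y}$.
   Context: Let $(\mathbf{K}, \preccurlyeq)$ be an AEC with amalgamation, joint embedding and arbitrarily large models, with monster model $\mathfrak{M}$, and $\mathrel{\perp\!\!\!\perp}$ a pre-independence relation on bounded subsets of $\mathfrak{M}$ (Invariance, Existence, Monotonicity, Base Monotonicity, Symmetry, Transitivity, Normality, Finite Character, Anti-Reflexivity). Semantics: $\mathfrak{M} \models_s \vec{x} \perp \vec{y}$ iff $s(\vec{x}) \mathrel{\perp\!\!\!\perp}_{\emptyset} s(\vec{y})$; $\Sigma \models \phi$ iff every assignment satisfying $\Sigma$ satisfies $\phi$. Deductive system: ($a_3$) $\vec{x} \perp \emptyset$; ($b_3$) $\vec{x} \perp \vec{y} \Rightarrow \vec{y} \perp \vec{x}$; ($c_3$) $\vec{x} \perp \vec{y}\vec{z} \Rightarrow \vec{x} \perp \vec{y}$; ($d_3$) $\vec{x} \perp \vec{y}$ and $\vec{x}\vec{y} \perp \vec{z} \Rightarrow \vec{x} \perp \vec{y}\vec{z}$; ($e_3$) $x \perp x \Rightarrow x \perp \vec{y}$; ($f_3$) $\vec{x} \perp \vec{y} \Rightarrow \pi\vec{x} \perp \sigma\vec{y}$ for permutations; ($g_3$) $\vec{x} y \vec{z} \perp \vec{w} \Rightarrow \vec{x}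 y y \vec{z} \perp \vec{w}$. An injective sequence $(a_i)$ is independent over $\emptyset$ if $(a_i \mid i<j) \mathrel{\perp\!\!\!\perp}_\emptyset a_j$ for all $j$; for $n \ge 1$, an independent $(a_i \mid i<n)$ is federated if some $d$ is not $\mathrel{\perp\!\!\!\perp}_\emptyset$-independent from $a_0\cdots a_{n-1}$ but $d \mathrel{\perp\!\!\!\perp}_\emptyset (a_i \mid i<n) - a_j$ for all $j<n$. $\mathrel{\perp\!\!\!\perp}$ is federated if for every $n \geq 1$ there is a federated sequence of length $n$ (over $\emptyset$). An algebraic point is $e \in \mathfrak{M}$ with $e \mathrel{\perp\!\!\!\perp}_\emptyset e$. *)

theory Defs
  imports Main "HOL-Library.Multiset"
begin

unbundle cardinal_syntax

section \<open>First-order structures\<close>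

text \<open>
  The symbols of a signature are given by sets, so that a signature may have no function
  symbols or no relation symbols.
\<close>

record ('f, 'r) signature =
  funs :: "'f set"
  rels :: "'r set"
  farity :: "'f \<Rightarrow> nat"
  rarity :: "'r \<Rightarrow> nat"

record ('f, 'r, 'u) fostruct =
  univ :: "'u set"
  fn :: "'f \<Rightarrow> 'u list \<Rightarrow> 'u"
  rel :: "'r \<Rightarrow> 'u list \<Rightarrow> bool"

definition fargs :: "('f, 'r) signature \<Rightarrow> ('f, 'r, 'u) fostruct \<Rightarrow> 'f \<Rightarrow> 'u list set" where
  "fargs L A f = {xs. f \<in> funs L \<and> length xs = farity L f \<and> set xs \<subseteq> univ A}"

definition rargs :: "('f, 'r) signature \<Rightarrow> ('f, 'r, 'u) fostruct \<Rightarrow> 'r \<Rightarrow> 'u list set" where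
  "rargs L A R = {xs. R \<in> rels L \<and> length xs = rarity L R \<and> set xs \<subseteq> univ A}"

text \<open>
  Interpretations take a fixed value at meaningless arguments, so that equality of structures
  in HOL is equality of structures.
\<close>

definition is_struct :: "('f, 'r) signature \<Rightarrow> ('f, 'r, 'u) fostruct \<Rightarrow> bool" where
  "is_struct L A \<longleftrightarrow>
     univ A \<noteq> {} \<and>
     (\<forall>f. \<forall>xs\<in>fargs L A f. fn A f xs \<in> univ A) \<and>
     (\<forall>f xs. xs \<notin> fargs L A f \<longrightarrow> fn A f xs = undefined) \<and>
     (\<forall>R xs. xs \<notin> rargs L A R \<longrightarrow> \<not> rel A R xs)"

definition substruct ::
  "('f, 'r) signature \<Rightarrow> ('f, 'r, 'u) fostruct \<Rightarrow> ('f, 'r, 'u) fostruct \<Rightarrow> bool" where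
  "substruct L A B \<longleftrightarrow>
     univ A \<subseteq> univ B \<and>
     (\<forall>f. \<forall>xs\<in>fargs L A f. fn A f xs = fn B f xs) \<and>
     (\<forall>R. \<forall>xs\<in>rargs L A R. rel A R xs \<longleftrightarrow> rel B R xs)"

definition struct_iso ::
  "('f, 'r) signature \<Rightarrow> ('u \<Rightarrow> 'u) \<Rightarrow> ('f, 'r, 'u) fostruct \<Rightarrow> ('f, 'r, 'u) fostruct \<Rightarrow> bool" where
  "struct_iso L h A B \<longleftrightarrow>
     bij_betw h (univ A) (univ B) \<and>
     (\<forall>f. \<forall>xs\<in>fargs L A f. h (fn A f xs) = fn B f (map h xs)) \<and>
     (\<forall>R. \<forall>xs\<in>rargs L A R. rel A R xs \<longleftrightarrow> rel B R (map h xs))"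

text \<open>
  For a nonempty family \<open>F\<close> that is directed under \<^const>\<open>substruct\<close>, the following determines
  \<open>U\<close> uniquely, and such a \<open>U\<close> exists.
\<close>

definition is_union ::
  "('f, 'r) signature \<Rightarrow> ('f, 'r, 'u) fostruct set \<Rightarrow> ('f, 'r, 'u) fostruct \<Rightarrow> bool" where
  "is_union L F U \<longleftrightarrow> is_struct L U \<and> univ U = (\<Union>A\<in>F. univ A) \<and> (\<forall>A\<in>F. substruct L A U)"


section \<open>Abstract elementary classes\<close>

text \<open>
  The class consists of structures with universe inside an arbitrary type \<open>'u\<close>, which plays the
  role of the universe of sets; cardinals are cardinal orders on \<open>'u\<close>. A chain
  \<open>(A\<^sub>i | i < \<delta>)\<close> is indexed by a well-order on a subset of \<open>'u\<close>: a strictly increasing chain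
  of subsets of \<open>'u\<close> has no longer index, and repetitions do not affect the union.
\<close>

definition limit_index :: "'i rel \<Rightarrow> 'i \<Rightarrow> bool" where
  "limit_index r i \<longleftrightarrow>
     i \<in> Field r \<and> underS r i \<noteq> {} \<and> (\<forall>j\<in>underS r i. \<exists>k\<in>underS r i. j \<in> underS r k)"

definition cont_chain ::
  "('f, 'r) signature \<Rightarrow> (('f, 'r, 'u) fostruct \<Rightarrow> ('f, 'r, 'u) fostruct \<Rightarrow> bool) \<Rightarrow>
   'u rel \<Rightarrow> ('u \<Rightarrow> ('f, 'r, 'u) fostruct) \<Rightarrow> bool" where
  "cont_chain L le r A \<longleftrightarrow>
     Well_order r \<and> Field r \<noteq> {} \<and>
     (\<forall>(i, j)\<in>r. le (A i) (A j)) \<and>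
     (\<forall>i. limit_index r i \<longrightarrow> is_union L (A ` underS r i) (A i))"

locale aec =
  fixes L :: "('f, 'r) signature"
    and K :: "('f, 'r, 'u) fostruct set"
    and le :: "('f, 'r, 'u) fostruct \<Rightarrow> ('f, 'r, 'u) fostruct \<Rightarrow> bool"
    and LS :: "'u rel"
  assumes K_struct: "A \<in> K \<Longrightarrow> is_struct L A"
    and le_K: "le A B \<Longrightarrow> A \<in> K \<and> B \<in> K"
    and K_iso: "\<lbrakk>A \<in> K; is_struct L B; struct_iso L h A B\<rbrakk> \<Longrightarrow> B \<in> K"
    and le_iso: "\<lbrakk>le A B; is_struct L A'; is_struct L B'; struct_iso L h A A'; struct_iso L h B B'\<rbrakk>
                 \<Longrightarrow> le A' B'"
    and le_substruct: "le A B \<Longrightarrow> substruct L A B"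
    and le_refl: "A \<in> K \<Longrightarrow> le A A"
    and le_antisym: "\<lbrakk>le A B; le B A\<rbrakk> \<Longrightarrow> A = B"
    and le_trans: "\<lbrakk>le A B; le B C\<rbrakk> \<Longrightarrow> le A C"
    and union_K: "\<lbrakk>cont_chain L le r F; is_union L (F ` Field r) U\<rbrakk> \<Longrightarrow> U \<in> K"
    and union_upper: "\<lbrakk>cont_chain L le r F; is_union L (F ` Field r) U; i \<in> Field r\<rbrakk>
                      \<Longrightarrow> le (F i) U"
    and union_least: "\<lbrakk>cont_chain L le r F; is_union L (F ` Field r) U; N \<in> K;
                       \<And>i. i \<in> Field r \<Longrightarrow> le (F i) N\<rbrakk> \<Longrightarrow> le U N"
    and coherence: "\<lbrakk>le A C; le B C; substruct L A B\<rbrakk> \<Longrightarrow> le A B"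
    and LS_card: "Card_order LS" "cinfinite LS" "LS <o |UNIV :: 'u set|"
    and LS_submodel: "\<lbrakk>A \<in> K; X \<subseteq> univ A\<rbrakk>
                      \<Longrightarrow> \<exists>C. X \<subseteq> univ C \<and> le C A \<and> |univ C| \<le>o |X| +c LS"

definition K_embedding ::
  "('f, 'r) signature \<Rightarrow> (('f, 'r, 'u) fostruct \<Rightarrow> ('f, 'r, 'u) fostruct \<Rightarrow> bool) \<Rightarrow>
   ('u \<Rightarrow> 'u) \<Rightarrow> ('f, 'r, 'u) fostruct \<Rightarrow> ('f, 'r, 'u) fostruct \<Rightarrow> bool" where
  "K_embedding L le h A B \<longleftrightarrow> (\<exists>C. le C B \<and> struct_iso L h A C)"

definition amalgamation ::
  "('f, 'r) signature \<Rightarrow> ('f, 'r, 'u) fostruct set \<Rightarrow>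
   (('f, 'r, 'u) fostruct \<Rightarrow> ('f, 'r, 'u) fostruct \<Rightarrow> bool) \<Rightarrow> bool" where
  "amalgamation L K le \<longleftrightarrow>
     (\<forall>A B C. le A B \<and> le A C \<longrightarrow>
        (\<exists>D\<in>K. \<exists>f g. K_embedding L le f B D \<and> K_embedding L le g C D \<and> (\<forall>a\<in>univ A. f a = g a)))"

definition joint_embedding ::
  "('f, 'r) signature \<Rightarrow> ('f, 'r, 'u) fostruct set \<Rightarrow>
   (('f, 'r, 'u) fostruct \<Rightarrow> ('f, 'r, 'u) fostruct \<Rightarrow> bool) \<Rightarrow> bool" where
  "joint_embedding L K le \<longleftrightarrow>
     (\<forall>A\<in>K. \<forall>B\<in>K. \<exists>C\<in>K. \<exists>f g. K_embedding L le f A C \<and> K_embedding L le g B C)"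

definition arbitrarily_large_models :: "('f, 'r, 'u) fostruct set \<Rightarrow> bool" where
  "arbitrarily_large_models K \<longleftrightarrow> (\<forall>X :: 'u set. \<exists>A\<in>K. |X| \<le>o |univ A| )"

definition monster_model ::
  "('f, 'r) signature \<Rightarrow> ('f, 'r, 'u) fostruct set \<Rightarrow>
   (('f, 'r, 'u) fostruct \<Rightarrow> ('f, 'r, 'u) fostruct \<Rightarrow> bool) \<Rightarrow> 'u rel \<Rightarrow>
   'u rel \<Rightarrow> ('f, 'r, 'u) fostruct \<Rightarrow> bool" where
  "monster_model L K le LS \<kappa> M \<longleftrightarrow>
     M \<in> K \<and> Card_order \<kappa> \<and> LS <o \<kappa> \<and> \<kappa> \<le>o |univ M| \<and>
     (\<forall>A\<in>K. |univ A| <o \<kappa> \<longrightarrow> (\<exists>h. K_embedding L le h A M)) \<and>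
     (\<forall>A B h. le A M \<and> le B M \<and> |univ A| <o \<kappa> \<and> struct_iso L h A B \<longrightarrow>
        (\<exists>g. struct_iso L g M M \<and> (\<forall>a\<in>univ A. g a = h a)))"


section \<open>Pre-independence relations\<close>

definition bdd_sub :: "('f, 'r, 'u) fostruct \<Rightarrow> 'u rel \<Rightarrow> 'u set \<Rightarrow> bool" where
  "bdd_sub M \<kappa> X \<longleftrightarrow> X \<subseteq> univ M \<and> |X| <o \<kappa>"

text \<open>\<open>ind A C B\<close> stands for: \<open>A\<close> is independent from \<open>B\<close> over \<open>C\<close>.\<close>

locale pre_independence =
  fixes L :: "('f, 'r) signature"
    and M :: "('f, 'r, 'u) fostruct"
    and \<kappa> :: "'u rel"
    and ind :: "'u set \<Rightarrow> 'u set \<Rightarrow> 'u set \<Rightarrow> bool"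
  assumes invariance:
      "\<lbrakk>bdd_sub M \<kappa> A; bdd_sub M \<kappa> B; bdd_sub M \<kappa> C; struct_iso L f M M; ind A C B\<rbrakk>
       \<Longrightarrow> ind (f ` A) (f ` C) (f ` B)"
    and existence:
      "\<lbrakk>bdd_sub M \<kappa> A; bdd_sub M \<kappa> B\<rbrakk> \<Longrightarrow> ind A A B"
    and monotonicity:
      "\<lbrakk>bdd_sub M \<kappa> A; bdd_sub M \<kappa> B; bdd_sub M \<kappa> C; A' \<subseteq> A; B' \<subseteq> B; ind A C B\<rbrakk>
       \<Longrightarrow> ind A' C B'"
    and base_monotonicity:
      "\<lbrakk>bdd_sub M \<kappa> A; bdd_sub M \<kappa> B; D \<subseteq> C; C \<subseteq> B; ind A D B\<rbrakk> \<Longrightarrow> ind A C B"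
    and symmetry:
      "\<lbrakk>bdd_sub M \<kappa> A; bdd_sub M \<kappa> B; bdd_sub M \<kappa> C; ind A C B\<rbrakk> \<Longrightarrow> ind B C A"
    and transitivity:
      "\<lbrakk>bdd_sub M \<kappa> A; bdd_sub M \<kappa> B; D \<subseteq> C; C \<subseteq> B; ind B C A; ind C D A\<rbrakk> \<Longrightarrow> ind B D A"
    and normality:
      "\<lbrakk>bdd_sub M \<kappa> A; bdd_sub M \<kappa> B; bdd_sub M \<kappa> C; ind A C B\<rbrakk> \<Longrightarrow> ind (A \<union> C) C B"
    and finite_character:
      "\<lbrakk>bdd_sub M \<kappa> A; bdd_sub M \<kappa> B; bdd_sub M \<kappa> C; \<And>A0. \<lbrakk>finite A0; A0 \<subseteq> A\<rbrakk> \<Longrightarrow> ind A0 C B\<rbrakk>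
       \<Longrightarrow> ind A C B"
    and anti_reflexivity:
      "\<lbrakk>bdd_sub M \<kappa> A; bdd_sub M \<kappa> B; bdd_sub M \<kappa> C; ind A B A\<rbrakk> \<Longrightarrow> ind A B C"

definition indep_seq ::
  "('f, 'r, 'u) fostruct \<Rightarrow> ('u set \<Rightarrow> 'u set \<Rightarrow> 'u set \<Rightarrow> bool) \<Rightarrow> 'u list \<Rightarrow> bool" where
  "indep_seq M ind as \<longleftrightarrow>
     set as \<subseteq> univ M \<and> distinct as \<and> (\<forall>j<length as. ind (set (take j as)) {} {as ! j})"

definition federated_seq ::
  "('f, 'r, 'u) fostruct \<Rightarrow> ('u set \<Rightarrow> 'u set \<Rightarrow> 'u set \<Rightarrow> bool) \<Rightarrow> 'u list \<Rightarrow> bool" where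
  "federated_seq M ind as \<longleftrightarrow>
     1 \<le> length as \<and> indep_seq M ind as \<and>
     (\<exists>d\<in>univ M. \<not> ind {d} {} (set as) \<and> (\<forall>j<length as. ind {d} {} (set as - {as ! j})))"

definition federated ::
  "('f, 'r, 'u) fostruct \<Rightarrow> ('u set \<Rightarrow> 'u set \<Rightarrow> 'u set \<Rightarrow> bool) \<Rightarrow> bool" where
  "federated M ind \<longleftrightarrow> (\<forall>n\<ge>1. \<exists>as. length as = n \<and> federated_seq M ind as)"

definition algebraic_point ::
  "('f, 'r, 'u) fostruct \<Rightarrow> ('u set \<Rightarrow> 'u set \<Rightarrow> 'u set \<Rightarrow> bool) \<Rightarrow> 'u \<Rightarrow> bool" where
  "algebraic_point M ind e \<longleftrightarrow> e \<in> univ M \<and> ind {e} {} {e}"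


section \<open>Atomic independence logic\<close>

datatype 'v ind_atom = Indep "'v list" "'v list"  (infix "\<perp>" 55)

fun sat_atom ::
  "('u set \<Rightarrow> 'u set \<Rightarrow> 'u set \<Rightarrow> bool) \<Rightarrow> ('v \<Rightarrow> 'u) \<Rightarrow> 'v ind_atom \<Rightarrow> bool" where
  "sat_atom ind s (xs \<perp> ys) \<longleftrightarrow> ind (s ` set xs) {} (s ` set ys)"

definition entails ::
  "('f, 'r, 'u) fostruct \<Rightarrow> ('u set \<Rightarrow> 'u set \<Rightarrow> 'u set \<Rightarrow> bool) \<Rightarrow>
   'v ind_atom set \<Rightarrow> 'v ind_atom \<Rightarrow> bool" where
  "entails M ind \<Sigma> \<phi> \<longleftrightarrow>
     (\<forall>s. range s \<subseteq> univ M \<and> (\<forall>\<psi>\<in>\<Sigma>. sat_atom ind s \<psi>) \<longrightarrow> sat_atom ind s \<phi>)"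

inductive deduces :: "'v ind_atom set \<Rightarrow> 'v ind_atom \<Rightarrow> bool"  (infix "\<turnstile>" 50)
  for \<Sigma> :: "'v ind_atom set" where
  hyp: "\<phi> \<in> \<Sigma> \<Longrightarrow> \<Sigma> \<turnstile> \<phi>"
| a3: "\<Sigma> \<turnstile> xs \<perp> []"
| b3: "\<Sigma> \<turnstile> xs \<perp> ys \<Longrightarrow> \<Sigma> \<turnstile> ys \<perp> xs"
| c3: "\<Sigma> \<turnstile> xs \<perp> (ys @ zs) \<Longrightarrow> \<Sigma> \<turnstile> xs \<perp> ys"
| d3: "\<Sigma> \<turnstile> xs \<perp> ys \<Longrightarrow> \<Sigma> \<turnstile> (xs @ ys) \<perp> zs \<Longrightarrow> \<Sigma> \<turnstile> xs \<perp> (ys @ zs)"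
| e3: "\<Sigma> \<turnstile> [x] \<perp> [x] \<Longrightarrow> \<Sigma> \<turnstile> [x] \<perp> ys"
| f3: "\<Sigma> \<turnstile> xs \<perp> ys \<Longrightarrow> mset xs' = mset xs \<Longrightarrow> mset ys' = mset ys \<Longrightarrow> \<Sigma> \<turnstile> xs' \<perp> ys'"
| g3: "\<Sigma> \<turnstile> (xs @ [y] @ zs) \<perp> ws \<Longrightarrow> \<Sigma> \<turnstile> (xs @ [y, y] @ zs) \<perp> ws"

end

theory Submission
  imports Defs
begin

text \<open>
  Suppose that the atom is not derivable and shrink its sides to \<open>A\<close> and \<open>B\<close>, still not derivable,
  such that every atom with smaller sides is derivable. Then no variable of \<open>A \<union> B\<close> is provably
  constant, where \<open>v\<close> is provably constant if \<open>v \<perp> v\<close> is derivable; so a common variable \<open>v\<close> of \<open>A\<close>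
  and \<open>B\<close> forces \<open>A = B = {v}\<close>. In that case \<open>v\<close> is sent to a non-algebraic point and all other
  variables to an algebraic one. Otherwise \<open>A\<close> and \<open>B\<close> are
  disjoint; one variable of \<open>A\<close> is sent to the witness \<open>d\<close> of a federated sequence, the remaining
  ones of \<open>A \<union> B\<close> to its members, and all other variables to an algebraic point. Any two disjoint
  sets of variables which do not exhaust \<open>A \<union> B\<close> have independent values, so this assignment can
  only violate a hypothesis whose sides partition \<open>A \<union> B\<close>; but from such a hypothesis and the
  atoms with smaller sides, the original atom is derivable.
\<close>

section \<open>Derivability in terms of sets of variables\<close>

lemma deduces_dup:
  assumes "\<Sigma> \<turnstile> xs \<perp> ys" "x \<in> set xs"
  shows "\<Sigma> \<turnstile> (x # xs) \<perp> ys"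
proof -
  obtain us vs where xs: "xs = us @ [x] @ vs"
    using assms(2) by (auto simp: in_set_conv_decomp)
  have "\<Sigma> \<turnstile> (us @ [x, x] @ vs) \<perp> ys"
    using assms(1) unfolding xs by (rule g3)
  then show ?thesis
    by (rule f3) (simp_all add: xs)
qed

text \<open>Each variable of \<open>zs\<close> is first copied in front of \<open>xs\<close>; then
  \<open>c3\<close>, conjugated by \<open>b3\<close>, drops \<open>xs\<close>.\<close>

lemma deduces_subset_left:
  assumes "\<Sigma> \<turnstile> xs \<perp> ys" "set zs \<subseteq> set xs"
  shows "\<Sigma> \<turnstile> zs \<perp> ys"
proof -
  have "\<Sigma> \<turnstile> (zs @ xs) \<perp> ys"
    using assms(2) by (induction zs) (use assms(1) in \<open>auto intro: deduces_dup\<close>)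
  then show ?thesis
    by (blast intro: b3 c3)
qed

lemma deduces_subset:
  assumes "\<Sigma> \<turnstile> xs \<perp> ys" "set xs' \<subseteq> set xs" "set ys' \<subseteq> set ys"
  shows "\<Sigma> \<turnstile> xs' \<perp> ys'"
  using assms by (meson b3 deduces_subset_left)

text \<open>Any other enumerations of \<open>A\<close> and \<open>B\<close> would serve as well, by
  \<open>deduces_subset\<close>; infinite sets never satisfy the relation.\<close>

definition deduces_sets :: "'v ind_atom set \<Rightarrow> 'v set \<Rightarrow> 'v set \<Rightarrow> bool" where
  "deduces_sets \<Sigma> A B \<longleftrightarrow> (\<exists>xs ys. set xs = A \<and> set ys = B \<and> \<Sigma> \<turnstile> xs \<perp> ys)"

lemma deduces_sets_iff: "deduces_sets \<Sigma> (set xs) (set ys) \<longleftrightarrow> \<Sigma> \<turnstile> xs \<perp> ys"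
  unfolding deduces_sets_def using deduces_subset by blast

lemma deduces_sets_finite:
  assumes "deduces_sets \<Sigma> A B"
  shows "finite A" "finite B"
  using assms unfolding deduces_sets_def by auto

lemma deduces_sets_mono:
  assumes "deduces_sets \<Sigma> A B" "A' \<subseteq> A" "B' \<subseteq> B"
  shows "deduces_sets \<Sigma> A' B'"
proof -
  obtain xs ys xs' ys' where "set xs = A" "set ys = B" "set xs' = A'" "set ys' = B'"
    using assms deduces_sets_finite[OF assms(1)] by (metis finite_list finite_subset)
  then show ?thesis
    using assms deduces_subset deduces_sets_iff by metis
qed

lemma deduces_sets_empty: "finite A \<Longrightarrow> deduces_sets \<Sigma> A {}"
  by (metis a3 deduces_sets_iff empty_set finite_list)

lemma deduces_sets_sym: "deduces_sets \<Sigma> A B \<Longrightarrow> deduces_sets \<Sigma> B A"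
  unfolding deduces_sets_def using b3 by blast

lemma deduces_sets_exchange:
  assumes "deduces_sets \<Sigma> A B" "deduces_sets \<Sigma> (A \<union> B) C"
  shows "deduces_sets \<Sigma> A (B \<union> C)"
proof -
  obtain xs ys zs where *: "set xs = A" "set ys = B" "set zs = C"
    using deduces_sets_finite[OF assms(1)] deduces_sets_finite[OF assms(2)] by (metis finite_list)
  then have "\<Sigma> \<turnstile> xs \<perp> ys" "\<Sigma> \<turnstile> (xs @ ys) \<perp> zs"
    using assms by (metis deduces_sets_iff, metis deduces_sets_iff set_append)
  then have "\<Sigma> \<turnstile> xs \<perp> (ys @ zs)"
    by (rule d3)
  then show ?thesis
    using * by (metis deduces_sets_iff set_append)
qed

lemma deduces_sets_constant:
  assumes "deduces_sets \<Sigma> {x} {x}" "finite B"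
  shows "deduces_sets \<Sigma> {x} B"
proof -
  obtain ys where "set ys = B"
    using assms(2) finite_list by blast
  moreover have "\<Sigma> \<turnstile> [x] \<perp> [x]"
    using assms(1) deduces_sets_iff[of \<Sigma> "[x]" "[x]"] by simp
  ultimately show ?thesis
    using e3 deduces_sets_iff[of \<Sigma> "[x]" ys] by fastforce
qed

text \<open>As \<open>x\<close> is provably independent of \<open>B \<union> A\<close>, the set form
  of \<open>d3\<close> adjoins \<open>x\<close> to the right side of
  \<open>B \<perp> A\<close>.\<close>

lemma deduces_sets_insert_constant:
  assumes "deduces_sets \<Sigma> {x} {x}" "deduces_sets \<Sigma> A B"
  shows "deduces_sets \<Sigma> (insert x A) B"
proof -
  have "deduces_sets \<Sigma> {x} (B \<union> A)"
    using assms deduces_sets_finite[OF assms(2)] by (simp add: deduces_sets_constant)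
  then have "deduces_sets \<Sigma> B (A \<union> {x})"
    using deduces_sets_exchange[OF deduces_sets_sym[OF assms(2)]] deduces_sets_sym by blast
  then show ?thesis
    using deduces_sets_sym by fastforce
qed

section \<open>Minimal underivable atoms\<close>

definition min_underivable :: "'v ind_atom set \<Rightarrow> 'v set \<Rightarrow> 'v set \<Rightarrow> bool" where
  "min_underivable \<Sigma> A B \<longleftrightarrow>
     finite A \<and> finite B \<and> \<not> deduces_sets \<Sigma> A B \<and>
     (\<forall>A' B'. A' \<subseteq> A \<and> B' \<subseteq> B \<and> (A', B') \<noteq> (A, B) \<longrightarrow> deduces_sets \<Sigma> A' B')"

lemma min_underivableD:
  assumes "min_underivable \<Sigma> A B"
  shows "finite A" "finite B" "\<not> deduces_sets \<Sigma> A B"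
    and "\<And>A' B'. A' \<subseteq> A \<Longrightarrow> B' \<subseteq> B \<Longrightarrow> A' \<noteq> A \<or> B' \<noteq> B \<Longrightarrow> deduces_sets \<Sigma> A' B'"
  using assms unfolding min_underivable_def by auto

lemma min_underivable_sym: "min_underivable \<Sigma> A B \<Longrightarrow> min_underivable \<Sigma> B A"
  unfolding min_underivable_def using deduces_sets_sym by (metis prod.inject)

lemma min_underivable_exists:
  assumes "finite A" "finite B" "\<not> deduces_sets \<Sigma> A B"
  shows "\<exists>A' B'. A' \<subseteq> A \<and> B' \<subseteq> B \<and> min_underivable \<Sigma> A' B'"
  using assms
proof (induction "card A + card B" arbitrary: A B rule: less_induct)
  case less
  show ?case
  proof (cases "min_underivable \<Sigma> A B")
    case False
    then obtain A' B' where *: "A' \<subseteq> A" "B' \<subseteq> B" "A' \<noteq> A \<or> B' \<noteq> B" "\<not> deduces_sets \<Sigma> A' B'"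
      unfolding min_underivable_def using less.prems by auto
    then have "card A' \<le> card A" "card B' \<le> card B" "card A' < card A \<or> card B' < card B"
      using less.prems by (simp_all add: card_mono) (metis psubset_card_mono psubsetI)
    then have "card A' + card B' < card A + card B"
      by linarith
    moreover have "finite A'" "finite B'"
      using * less.prems finite_subset by auto
    ultimately show ?thesis
      using less.hyps * by (meson order_trans)
  qed auto
qed

lemma min_underivable_nonempty:
  assumes "min_underivable \<Sigma> A B"
  shows "A \<noteq> {}" "B \<noteq> {}"
  using min_underivableD(1-3)[OF assms] deduces_sets_empty deduces_sets_sym by metis+

text \<open>Removing a constant leaves a smaller atom, derivable by minimality, and a constant can
  always be put back.\<close>

lemma min_underivable_not_constant:
  assumes "min_underivable \<Sigma> A B" "x \<in> A \<union> B"
  shows "\<not> deduces_sets \<Sigma> {x} {x}"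
proof
  assume const: "deduces_sets \<Sigma> {x} {x}"
  \<comment> \<open>Restated for arbitrary \<open>A\<close> and \<open>B\<close>, so that symmetry
    covers a constant in the right side.\<close>
  have False if "min_underivable \<Sigma> A B" "x \<in> A" for A B
  proof -
    have "deduces_sets \<Sigma> (A - {x}) B"
      using that(2) by (intro min_underivableD(4)[OF that(1)]) auto
    then have "deduces_sets \<Sigma> (insert x (A - {x})) B"
      by (rule deduces_sets_insert_constant[OF const])
    then show False
      using min_underivableD(3)[OF that(1)] that(2) by (simp add: insert_absorb)
  qed
  then show False
    using assms min_underivable_sym by blast
qed

text \<open>For a common variable \<open>x\<close>, the atom \<open>x \<perp> x\<close> is
  underivable and lies below the given one, so minimality identifies the two.\<close>

lemma min_underivable_cases:
  assumes "min_underivable \<Sigma> A B"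
  obtains (diagonal) x where "A = {x}" "B = {x}" | (disjoint) "A \<inter> B = {}"
proof (cases "A \<inter> B = {}")
  case False
  then obtain x where "x \<in> A" "x \<in> B" by blast
  moreover from this have "\<not> deduces_sets \<Sigma> {x} {x}"
    using min_underivable_not_constant[OF assms] by blast
  ultimately have "A = {x}" "B = {x}"
    using min_underivableD(4)[OF assms, of "{x}" "{x}"] by auto
  then show ?thesis
    by (rule diagonal)
qed (rule disjoint)

text \<open>The traces of \<open>A\<close> and \<open>B\<close> on either block form a strictly
  smaller atom, since the other block is nonempty. Both atoms are derivable by minimality, and
  together with \<open>U \<perp> W\<close> they rebuild \<open>A \<perp> B\<close>.\<close>

lemma min_underivable_no_partition:
  assumes min: "min_underivable \<Sigma> A B"
    and ded: "deduces_sets \<Sigma> U W" and un: "U \<union> W = A \<union> B" and disj: "U \<inter> W = {}"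
    and ne: "U \<noteq> {}" "W \<noteq> {}"
  shows False
proof -
  have U: "deduces_sets \<Sigma> (A \<inter> U) (B \<inter> U)" and W: "deduces_sets \<Sigma> (A \<inter> W) (B \<inter> W)"
    using assms by (intro min_underivableD(4)[OF min]; blast)+
  \<comment> \<open>Inside \<open>U\<close> the traces are independent, and \<open>U\<close> is
    independent of \<open>W\<close>, so \<open>B \<inter> U\<close> becomes independent of all of
    \<open>A\<close>.\<close>
  have "deduces_sets \<Sigma> (B \<inter> U) ((A \<inter> U) \<union> (A \<inter> W))"
  proof (rule deduces_sets_exchange)
    show "deduces_sets \<Sigma> (B \<inter> U) (A \<inter> U)"
      using U by (rule deduces_sets_sym)
    show "deduces_sets \<Sigma> (B \<inter> U \<union> A \<inter> U) (A \<inter> W)"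
      by (rule deduces_sets_mono[OF ded]) blast+
  qed
  moreover have "(A \<inter> U) \<union> (A \<inter> W) = A"
    using un by blast
  ultimately have "deduces_sets \<Sigma> A (B \<inter> U)"
    by (simp add: deduces_sets_sym)
  moreover have "deduces_sets \<Sigma> (A \<union> B \<inter> U) (B \<inter> W)"
  proof -
    \<comment> \<open>The same exchange inside \<open>W\<close>; the set
      \<open>(A \<inter> W) \<union> U\<close> contains \<open>A \<union> (B \<inter> U)\<close>, to
      which it is then restricted.\<close>
    have "deduces_sets \<Sigma> (B \<inter> W) ((A \<inter> W) \<union> U)"
    proof (rule deduces_sets_exchange)
      show "deduces_sets \<Sigma> (B \<inter> W) (A \<inter> W)"
        using W by (rule deduces_sets_sym)
      show "deduces_sets \<Sigma> (B \<inter> W \<union> A \<inter> W) U"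
        by (rule deduces_sets_mono[OF deduces_sets_sym[OF ded]]) blast+
    qed
    then have "deduces_sets \<Sigma> ((A \<inter> W) \<union> U) (B \<inter> W)"
      by (rule deduces_sets_sym)
    then show ?thesis
      by (rule deduces_sets_mono) (use un in blast)+
  qed
  ultimately have "deduces_sets \<Sigma> A (B \<inter> U \<union> B \<inter> W)"
    by (rule deduces_sets_exchange)
  moreover have "B \<inter> U \<union> B \<inter> W = B"
    using un by blast
  ultimately show False
    using min_underivableD(3)[OF min] by simp
qed

section \<open>Independence of finite sets over the empty set\<close>

text \<open>The axioms of independence speak of bounded sets; \<open>finite_bdd\<close> opens them
  to the finite sets of values taken by the sides of an atom.\<close>

locale finitely_bounded_independence = pre_independence L M \<kappa> ind
  for L :: "('f, 'r) signature" and M :: "('f, 'r, 'u) fostruct" and \<kappa> :: "'u rel"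
    and ind :: "'u set \<Rightarrow> 'u set \<Rightarrow> 'u set \<Rightarrow> bool" +
  assumes finite_bdd: "\<lbrakk>finite X; X \<subseteq> univ M\<rbrakk> \<Longrightarrow> bdd_sub M \<kappa> X"
begin

definition fin_sub :: "'u set \<Rightarrow> bool" where
  "fin_sub X \<longleftrightarrow> finite X \<and> X \<subseteq> univ M"

lemma fin_sub_simps [simp]:
  "fin_sub {}" "fin_sub (A \<union> B) \<longleftrightarrow> fin_sub A \<and> fin_sub B"
  "fin_sub (insert a A) \<longleftrightarrow> a \<in> univ M \<and> fin_sub A"
  unfolding fin_sub_def by auto

lemma fin_sub_subset: "\<lbrakk>fin_sub B; A \<subseteq> B\<rbrakk> \<Longrightarrow> fin_sub A"
  unfolding fin_sub_def using finite_subset by auto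

lemma fin_sub_bdd: "fin_sub X \<Longrightarrow> bdd_sub M \<kappa> X"
  unfolding fin_sub_def using finite_bdd by blast

lemma ind_empty_left: "fin_sub B \<Longrightarrow> ind {} {} B"
  by (simp add: existence fin_sub_bdd)

lemma ind_sym: "\<lbrakk>fin_sub A; fin_sub B; ind A {} B\<rbrakk> \<Longrightarrow> ind B {} A"
  by (rule symmetry) (auto simp: fin_sub_bdd)

lemma ind_mono: "\<lbrakk>ind A {} B; fin_sub A; fin_sub B; A' \<subseteq> A; B' \<subseteq> B\<rbrakk> \<Longrightarrow> ind A' {} B'"
  by (rule monotonicity[of A B "{}"]) (auto simp: fin_sub_bdd)

text \<open>The semantic counterpart of \<open>d3\<close>: the base is raised from \<open>{}\<close>
  to \<open>B\<close> and brought back by transitivity.\<close>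

lemma ind_exchange:
  assumes fin: "fin_sub A" "fin_sub B" "fin_sub C" and "ind A {} B" "ind (A \<union> B) {} C"
  shows "ind A {} (B \<union> C)"
proof -
  have bdd: "bdd_sub M \<kappa> A" "bdd_sub M \<kappa> B" "bdd_sub M \<kappa> C" "bdd_sub M \<kappa> (A \<union> B)"
      "bdd_sub M \<kappa> (C \<union> B)"
    using fin by (auto intro: fin_sub_bdd)
  have "ind C {} (A \<union> B)"
    using assms ind_sym[of "A \<union> B" C] by simp
  then have "ind C B (A \<union> B)"
    using bdd base_monotonicity[of C "A \<union> B" "{}" B] by auto
  then have "ind C B A"
    using bdd monotonicity[of C "A \<union> B" B C A] by auto
  \<comment> \<open>Normality puts the base into the left set, the form that transitivity
    needs.\<close>
  then have "ind (C \<union> B) B A"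
    using bdd normality by blast
  moreover have "ind B {} A"
    using assms ind_sym by blast
  ultimately have "ind (C \<union> B) {} A"
    using bdd transitivity[of A "C \<union> B" "{}" B] by auto
  then show ?thesis
    using fin by (subst Un_commute) (auto intro: ind_sym)
qed

lemma ind_insert_left:
  assumes "fin_sub A" "fin_sub B" "a \<in> univ M" "ind A {} B" "ind {a} {} (A \<union> B)"
  shows "ind (insert a A) {} B"
proof -
  have "ind B {} (A \<union> {a})"
    using assms by (intro ind_exchange) (auto intro: ind_sym simp: Un_commute)
  then show ?thesis
    using assms ind_sym by force
qed

lemma ind_insert_right:
  assumes "fin_sub A" "fin_sub B" "a \<in> univ M" "ind A {} B" "ind {a} {} (A \<union> B)"
  shows "ind A {} (insert a B)"
  using assms ind_insert_left[of B A a] ind_sym[of A B] ind_sym[of "insert a B" A]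
  by (simp add: Un_commute)

lemma algebraic_ind:
  assumes "algebraic_point M ind e" "fin_sub B"
  shows "ind {e} {} B"
  using assms anti_reflexivity[of "{e}" "{}" B] by (simp add: algebraic_point_def fin_sub_bdd)

text \<open>Inclusions rather than equalities, because in the countermodels the irrelevant variables
  all take the value \<open>e\<close>, which may or may not occur in a given side.\<close>

lemma ind_algebraic_superset:
  assumes "algebraic_point M ind e" "fin_sub A" "fin_sub B" "ind A {} B"
    and "A' \<subseteq> insert e A" "B' \<subseteq> insert e B"
  shows "ind A' {} B'"
proof -
  have e: "e \<in> univ M"
    using assms(1) by (simp add: algebraic_point_def)
  then have "ind (insert e A) {} B"
    using assms by (simp add: ind_insert_left algebraic_ind)
  then have "ind (insert e A) {} (insert e B)"
    using assms e algebraic_ind[OF assms(1), of "insert e A \<union> B"] by (simp add: ind_insert_right)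
  then show ?thesis
    by (rule ind_mono) (use assms e in simp_all)
qed

lemma indep_seq_snoc:
  assumes "indep_seq M ind (as @ [a])"
  shows "indep_seq M ind as" "ind (set as) {} {a}"
proof -
  have step: "ind (set (take j (as @ [a]))) {} {(as @ [a]) ! j}" if "j < Suc (length as)" for j
    using assms that unfolding indep_seq_def by simp
  show "ind (set as) {} {a}"
    using step[of "length as"] by simp
  have "ind (set (take j as)) {} {as ! j}" if "j < length as" for j
    using step[of j] that by (simp add: nth_append)
  then show "indep_seq M ind as"
    using assms unfolding indep_seq_def by simp
qed

text \<open>The definition only compares initial segments with the next entry. The last entry is
  independent of all earlier ones together, so it can be adjoined to whichever of \<open>P\<close>
  and \<open>Q\<close> contains it.\<close>

lemma indep_seq_disjoint_subsets:
  assumes "indep_seq M ind as" "P \<subseteq> set as" "Q \<subseteq> set as" "P \<inter> Q = {}"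
  shows "ind P {} Q"
  using assms
proof (induction as arbitrary: P Q rule: rev_induct)
  case Nil
  then show ?case by (simp add: ind_empty_left)
next
  case (snoc a as)
  have fin: "fin_sub (set as)" "a \<in> univ M"
    using snoc.prems(1) unfolding indep_seq_def fin_sub_def by auto
  define P' Q' where "P' = P - {a}" and "Q' = Q - {a}"
  have sub: "P' \<subseteq> set as" "Q' \<subseteq> set as"
    using snoc.prems unfolding P'_def Q'_def by auto
  then have fin': "fin_sub P'" "fin_sub Q'"
    using fin fin_sub_subset by blast+
  have PQ': "ind P' {} Q'"
    using snoc.prems sub
    by (intro snoc.IH indep_seq_snoc(1)[OF snoc.prems(1)]) (auto simp: P'_def Q'_def)
  have "ind {a} {} (set as)"
    using indep_seq_snoc(2)[OF snoc.prems(1)] fin ind_sym[of "set as" "{a}"] by simp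
  then have a: "ind {a} {} (P' \<union> Q')"
    using fin sub by (auto intro: ind_mono)
  consider "P = P'" "Q = Q'" | "P = insert a P'" "Q = Q'" | "P = P'" "Q = insert a Q'"
    using snoc.prems(4) unfolding P'_def Q'_def by blast
  then show ?case
    using PQ' a fin fin' ind_insert_left ind_insert_right by cases auto
qed

section \<open>Refuting assignments\<close>

lemma diagonal_countermodel:
  assumes alg: "algebraic_point M ind e" and fed: "federated M ind"
    and min: "min_underivable \<Sigma> {x} {x}"
  obtains s where "range s \<subseteq> univ M" "\<And>\<psi>. \<psi> \<in> \<Sigma> \<Longrightarrow> sat_atom ind s \<psi>"
    and "\<not> ind (s ` {x}) {} (s ` {x})"
proof -
  \<comment> \<open>Length one suffices: the single entry \<open>a\<close> depends on the witness
    \<open>d\<close>, whereas an algebraic point would be independent of it.\<close>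
  obtain as where as: "length as = 1" "federated_seq M ind as"
    using fed unfolding federated_def by auto
  then obtain a where "as = [a]"
    by (auto simp: length_Suc_conv)
  then obtain d where ad: "a \<in> univ M" "d \<in> univ M" "\<not> ind {d} {} {a}"
    using as(2) unfolding federated_seq_def indep_seq_def by auto
  have na: "\<not> algebraic_point M ind a"
    using ad algebraic_ind[of a "{d}"] ind_sym[of "{a}" "{d}"] by auto
  have e: "e \<in> univ M"
    using alg by (simp add: algebraic_point_def)
  define s where "s = (\<lambda>v. if v = x then a else e)"
  have "sat_atom ind s \<psi>" if "\<psi> \<in> \<Sigma>" for \<psi>
  proof (cases \<psi>)
    case (Indep us ws)
    then have "deduces_sets \<Sigma> (set us) (set ws)"
      using that by (auto simp: deduces_sets_iff intro: hyp)
    \<comment> \<open>A hypothesis with \<open>x\<close> on both sides would derive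
      \<open>x \<perp> x\<close> by weakening; so one side takes no value but
      \<open>e\<close>.\<close>
    then have "x \<notin> set us \<or> x \<notin> set ws"
      using min_underivableD(3)[OF min] deduces_sets_mono[of \<Sigma> _ _ "{x}" "{x}"] by auto
    moreover have "ind {} {} {a}" "ind {a} {} {}"
      using ad ind_empty_left ind_sym[of "{}" "{a}"] by auto
    ultimately have "ind (s ` set us) {} (s ` set ws)"
      using ad ind_algebraic_superset[OF alg, of "{}" "{a}" "s ` set us" "s ` set ws"]
        ind_algebraic_superset[OF alg, of "{a}" "{}" "s ` set us" "s ` set ws"]
      by (auto simp: s_def image_subset_iff)
    then show ?thesis
      using Indep by simp
  qed
  moreover have "range s \<subseteq> univ M" "\<not> ind (s ` {x}) {} (s ` {x})"
    using ad e na by (auto simp: s_def algebraic_point_def)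
  ultimately show ?thesis
    using that by blast
qed

text \<open>A proper part of \<open>V\<close> either omits \<open>x\<close>, and then only entries
  of an independent sequence occur, or omits another variable, and then federation makes the value
  of \<open>x\<close> independent of the rest. The condition \<open>V \<noteq> {x}\<close> keeps the
  sequence nonempty.\<close>

lemma federated_assignment:
  assumes fed: "federated M ind" and V: "finite V" "x \<in> V" "V \<noteq> {x}"
  obtains t where "t ` V \<subseteq> univ M" "\<not> ind {t x} {} (t ` (V - {x}))"
    and "\<And>P Q. \<lbrakk>P \<inter> Q = {}; P \<union> Q \<subset> V\<rbrakk> \<Longrightarrow> ind (t ` P) {} (t ` Q)"
proof -
  define W where "W = V - {x}"
  have W: "finite W" "W \<noteq> {}" "V = insert x W" "x \<notin> W"
    using V by (auto simp: W_def)
  then have "1 \<le> card W"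
    by (simp add: Suc_leI card_gt_0_iff)
  then obtain as d where len: "length as = card W" and seq: "indep_seq M ind as"
    and d: "d \<in> univ M" "\<not> ind {d} {} (set as)"
    and miss: "\<And>j. j < length as \<Longrightarrow> ind {d} {} (set as - {as ! j})"
    using fed unfolding federated_def federated_seq_def by metis
  have as: "set as \<subseteq> univ M" "distinct as"
    using seq unfolding indep_seq_def by auto
  then have "card W = card (set as)"
    using len by (simp add: distinct_card)
  then obtain f where f: "bij_betw f W (set as)"
    using W(1) by (metis List.finite_set finite_same_card_bij)
  define t where "t = f(x := d)"
  have tx: "t x = d"
    by (simp add: t_def)
  have tf: "t ` P = f ` P" if "P \<subseteq> W" for P
    using that W(4) unfolding t_def by (auto simp: image_iff)
  have fas: "f ` P \<subseteq> set as" if "P \<subseteq> W" for P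
    using that f by (auto simp: bij_betw_def)
  have inj: "inj_on f W" and fW: "f ` W = set as"
    using f by (auto simp: bij_betw_def)
  have fin_as: "fin_sub (set as)"
    using as by (simp add: fin_sub_def)
  have fin: "fin_sub (f ` P)" if "P \<subseteq> W" for P
    using fas[OF that] fin_as fin_sub_subset by blast
  have indW: "ind (f ` P) {} (f ` Q)" if "P \<subseteq> W" "Q \<subseteq> W" "P \<inter> Q = {}" for P Q
  proof (rule indep_seq_disjoint_subsets[OF seq])
    show "f ` P \<inter> f ` Q = {}"
      using that inj by (metis image_empty inj_on_image_Int)
  qed (use that fas in auto)
  have dW: "ind {d} {} (f ` P)" if P: "P \<subset> W" for P
  proof -
    obtain w where w: "w \<in> W" "w \<notin> P"
      using P by blast
    then obtain j where j: "j < length as" "as ! j = f w"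
      using fW by (metis imageI in_set_conv_nth)
    \<comment> \<open>Injectivity of \<open>f\<close> keeps the value of the omitted variable
      \<open>w\<close> out of the image of \<open>P\<close>.\<close>
    have "f ` P \<subseteq> set as - {f w}"
      using fas[of P] P w inj by (auto dest: inj_onD)
    then show ?thesis
      using miss[OF j(1)] j(2) d(1) fin_as
      by (auto intro: ind_mono fin_sub_subset[OF fin_as])
  qed
  show ?thesis
  proof
    show "t ` V \<subseteq> univ M"
      using W(3) d(1) as(1) fW tf[of W] by (auto simp: t_def)
    show "\<not> ind {t x} {} (t ` (V - {x}))"
      using d(2) fW tf[of W] W_def by (simp add: t_def)
    fix P Q assume PQ: "P \<inter> Q = {}" "P \<union> Q \<subset> V"
    define P' Q' where "P' = P - {x}" and "Q' = Q - {x}"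
    have sub: "P' \<subseteq> W" "Q' \<subseteq> W"
      using PQ(2) W unfolding P'_def Q'_def by auto
    have "P' \<inter> Q' = {}"
      using PQ(1) unfolding P'_def Q'_def by blast
    then have base: "ind (t ` P') {} (t ` Q')" "fin_sub (t ` P')" "fin_sub (t ` Q')"
      using indW[of P' Q'] sub tf fin by auto
    have dPQ: "ind {d} {} (t ` P' \<union> t ` Q')" if "x \<in> P \<union> Q"
    proof -
      have "P' \<union> Q' \<subset> W"
        using that PQ(2) W unfolding P'_def Q'_def by blast
      then show ?thesis
        using dW[of "P' \<union> Q'"] tf sub by (simp add: image_Un)
    qed
    consider "P = P'" "Q = Q'" | "P = insert x P'" "Q = Q'" "x \<in> P"
      | "P = P'" "Q = insert x Q'" "x \<in> Q"
      using PQ(1) unfolding P'_def Q'_def by blast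
    then show "ind (t ` P) {} (t ` Q)"
    proof cases
      case 1
      then show ?thesis using base by simp
    next
      case 2
      have "t ` P = insert d (t ` P')"
        by (subst 2(1)) (simp add: tx)
      then show ?thesis
        using ind_insert_left[OF base(2,3) d(1) base(1)] dPQ 2 by simp
    next
      case 3
      have "t ` Q = insert d (t ` Q')"
        by (subst 3(2)) (simp add: tx)
      then show ?thesis
        using ind_insert_right[OF base(2,3) d(1) base(1)] dPQ 3 by simp
    qed
  qed
qed

lemma disjoint_countermodel:
  assumes alg: "algebraic_point M ind e" and fed: "federated M ind"
    and min: "min_underivable \<Sigma> A B" and disj: "A \<inter> B = {}"
  obtains s where "range s \<subseteq> univ M" "\<And>\<psi>. \<psi> \<in> \<Sigma> \<Longrightarrow> sat_atom ind s \<psi>"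
    and "\<not> ind (s ` A) {} (s ` B)"
proof -
  define V where "V = A \<union> B"
  obtain x where x: "x \<in> A"
    using min_underivable_nonempty(1)[OF min] by blast
  have V: "finite V" "x \<in> V" "V \<noteq> {x}"
    using min_underivableD(1,2)[OF min] min_underivable_nonempty[OF min] x disj
    by (auto simp: V_def)
  obtain t where t: "t ` V \<subseteq> univ M" "\<not> ind {t x} {} (t ` (V - {x}))"
    and small: "\<And>P Q. \<lbrakk>P \<inter> Q = {}; P \<union> Q \<subset> V\<rbrakk> \<Longrightarrow> ind (t ` P) {} (t ` Q)"
    using federated_assignment[OF fed V] by blast
  have fin: "fin_sub (t ` P)" if "P \<subseteq> V" for P
    using that t(1) V(1) finite_subset unfolding fin_sub_def by blast
  have e: "e \<in> univ M"
    using alg by (simp add: algebraic_point_def)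
  define s where "s = (\<lambda>v. if v \<in> V then t v else e)"
  have "sat_atom ind s \<psi>" if "\<psi> \<in> \<Sigma>" for \<psi>
  proof (cases \<psi>)
    case (Indep us ws)
    define U W where "U = set us \<inter> V" and "W = set ws \<inter> V"
    have UW: "U \<subseteq> V" "W \<subseteq> V"
      by (auto simp: U_def W_def)
    have "deduces_sets \<Sigma> (set us) (set ws)"
      using that Indep by (auto simp: deduces_sets_iff intro: hyp)
    then have ded: "deduces_sets \<Sigma> U W"
      by (rule deduces_sets_mono) (auto simp: U_def W_def)
    \<comment> \<open>A variable on both sides would be provably constant, which minimality
      excludes.\<close>
    have "U \<inter> W = {}"
    proof (rule ccontr)
      assume "U \<inter> W \<noteq> {}"
      then obtain v where "v \<in> U" "v \<in> W" by blast
      moreover from this have "deduces_sets \<Sigma> {v} {v}"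
        using deduces_sets_mono[OF ded] by simp
      ultimately show False
        using min_underivable_not_constant[OF min] UW(1) unfolding V_def by blast
    qed
    \<comment> \<open>Equality would make the hypothesis a partition of \<open>V\<close>. The case
      of an empty side is set apart, since such an atom holds whatever the other side is.\<close>
    moreover have "U \<union> W \<subset> V" if "U \<noteq> {}" "W \<noteq> {}"
      using min_underivable_no_partition[OF min ded] that UW \<open>U \<inter> W = {}\<close>
      unfolding V_def by blast
    ultimately have "ind (t ` U) {} (t ` W)"
      using small[of U W] ind_empty_left[of "t ` W"] ind_sym[of "{}" "t ` U"]
        ind_empty_left[of "t ` U"] fin[OF UW(1)] fin[OF UW(2)]
      by (cases "U = {}"; cases "W = {}") auto
    moreover have "s ` set us \<subseteq> insert e (t ` U)" "s ` set ws \<subseteq> insert e (t ` W)"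
      by (auto simp: s_def U_def W_def)
    ultimately have "ind (s ` set us) {} (s ` set ws)"
      by (rule ind_algebraic_superset[OF alg fin[OF UW(1)] fin[OF UW(2)]])
    then show ?thesis
      using Indep by simp
  qed
  moreover have "range s \<subseteq> univ M"
    using t(1) e by (auto simp: s_def)
  moreover have "\<not> ind (s ` A) {} (s ` B)"
  proof
    assume "ind (s ` A) {} (s ` B)"
    then have AB: "ind (t ` A) {} (t ` B)"
      by (simp add: s_def V_def cong: image_cong)
    have A: "t ` A = insert (t x) (t ` (A - {x}))"
      using x by blast
    have VA: "A \<subseteq> V" "B \<subseteq> V" "A - {x} \<subseteq> V" "{x} \<subseteq> V"
      using x by (auto simp: V_def)
    \<comment> \<open>As \<open>B\<close> is nonempty and disjoint from \<open>A\<close>, the value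
      of \<open>x\<close> is independent of the rest of \<open>A\<close>; exchange with the assumed
      independence would extend this to all of \<open>V - {x}\<close>, against the choice of
      \<open>t\<close>.\<close>
    have "{x} \<union> (A - {x}) \<subset> V"
      using x min_underivable_nonempty(2)[OF min] disj unfolding V_def by auto
    then have "ind (t ` {x}) {} (t ` (A - {x}))"
      by (intro small) auto
    then have "ind {t x} {} (t ` (A - {x}) \<union> t ` B)"
      using AB fin[OF VA(2)] fin[OF VA(3)] fin[OF VA(4)] by (intro ind_exchange) (simp_all flip: A)
    moreover have "t ` (A - {x}) \<union> t ` B = t ` (V - {x})"
      using x disj unfolding V_def by blast
    ultimately show False
      using t(2) by simp
  qed
  ultimately show ?thesis
    using that by blast
qed

text \<open>By monotonicity, an assignment that refutes the minimal atom below
  \<open>xs \<perp> ys\<close> refutes \<open>xs \<perp> ys\<close> itself.\<close>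

lemma entails_imp_deduces:
  assumes alg: "algebraic_point M ind e" and fed: "federated M ind"
    and ent: "entails M ind \<Sigma> (xs \<perp> ys)"
  shows "\<Sigma> \<turnstile> xs \<perp> ys"
proof (rule ccontr)
  assume "\<not> \<Sigma> \<turnstile> xs \<perp> ys"
  then obtain A B where sub: "A \<subseteq> set xs" "B \<subseteq> set ys" and min: "min_underivable \<Sigma> A B"
    using min_underivable_exists by (metis List.finite_set deduces_sets_iff)
  obtain s where s: "range s \<subseteq> univ M" "\<And>\<psi>. \<psi> \<in> \<Sigma> \<Longrightarrow> sat_atom ind s \<psi>"
    and neg: "\<not> ind (s ` A) {} (s ` B)"
    using min
  proof (cases rule: min_underivable_cases)
    case (diagonal x)
    then show ?thesis
      using diagonal_countermodel[OF alg fed] min that by metis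
  next
    case disjoint
    then show ?thesis
      using disjoint_countermodel[OF alg fed min] that by metis
  qed
  have "ind (s ` set xs) {} (s ` set ys)"
    using ent s unfolding entails_def by auto
  moreover have "fin_sub (s ` set xs)" "fin_sub (s ` set ys)"
    using s(1) by (auto simp: fin_sub_def)
  ultimately show False
    using neg sub ind_mono image_mono by metis
qed

end

section \<open>Boundedness of finite subsets of the monster model, and completeness for it\<close>

lemma monster_finite_bdd:
  assumes "aec L K le LS" "monster_model L K le LS \<kappa> M" "finite X" "X \<subseteq> univ M"
  shows "bdd_sub M \<kappa> X"
proof -
  have "LS <o \<kappa>"
    using assms(2) by (simp add: monster_model_def)
  \<comment> \<open>The cardinal \<open>LS\<close> is infinite, so it exceeds every finite set and
    links it to \<open>\<kappa>\<close>.\<close>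
  moreover have "|X| <o LS"
    using aec.LS_card(1,2)[OF assms(1)] assms(3)
    by (intro finite_ordLess_infinite card_of_Well_order)
      (auto simp: cinfinite_def card_order_on_def Field_card_of)
  ultimately have "|X| <o \<kappa>"
    using ordLess_transitive by blast
  then show ?thesis
    using assms(4) by (simp add: bdd_sub_def)
qed

theorem theorem4p5:
  fixes L :: "('f, 'r) signature"
    and K :: "('f, 'r, 'u) fostruct set"
    and le :: "('f, 'r, 'u) fostruct \<Rightarrow> ('f, 'r, 'u) fostruct \<Rightarrow> bool"
    and LS \<kappa> :: "'u rel"
    and M :: "('f, 'r, 'u) fostruct"
    and ind :: "'u set \<Rightarrow> 'u set \<Rightarrow> 'u set \<Rightarrow> bool"
  assumes "aec L K le LS"
    and "amalgamation L K le"
    and "joint_embedding L K le"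
    and "arbitrarily_large_models K"
    and "monster_model L K le LS \<kappa> M"
    and "pre_independence L M \<kappa> ind"
    and "federated M ind"
    and "\<exists>e. algebraic_point M ind e"
  shows "\<forall>(\<Sigma> :: 'v ind_atom set) xs ys. entails M ind \<Sigma> (xs \<perp> ys) \<longrightarrow> \<Sigma> \<turnstile> xs \<perp> ys"
proof -
  interpret finitely_bounded_independence L M \<kappa> ind
    using assms(6) monster_finite_bdd[OF assms(1,5)]
    by (simp add: finitely_bounded_independence_def finitely_bounded_independence_axioms_def)
  show ?thesis
    using assms(7,8) entails_imp_deduces by blast
qed

end
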